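(* Neither the uniformity measure $I_U$ nor the coverage measure $I_C$ is standout consistent.
   Context: For $x,y\in\mathbb{R}^d$, $y$ dominates $x$ if $x_i\le y_i$ for all $i\in[d]$ and $x_j<y_j$ for some $j\in[d]$. A set of alternatives is a finite set $A\subseteq\mathbb{R}^d$ ($d\ge 1$ arbitrary) none of whose elements is dominated by another element of $A$. Let $\|x-y\|=\sum_{i=1}^d|x_i-y_i|$ and $\|x-y\|_+=\sum_{i=1}^d\max(x_i-y_i,0)$. For nonempty $S\subseteq A$, $I_U(S)=\min_{x,y\in S,\,x\neq y}\|x-y\|$ ($+\infty$ if $|S|=1$; higher is better) and $I_C(S,A)=\max_{a\in A}\min_{s\in S}\|a-s\|$ (lower is better). For a positive integer $k$, $\mathcal{S}(I,A,k)$ is the set of all $S\subseteq A$ with $|S|=k$ that are optimal for $I$ among the size-$k$ subsets of $A$ (maximizing $I_U$, respectively minimizing $I_C(\cdot,A)$). An alternative $x\in A$ is a standout alternative if $\min_{a\in A\setminus\{x\}}\|x-a\|_+>\max_{a\in A\setminus\{x\}}\|a-x\|_+$. A measure $I$ is standout consistent if for any set of alternatives $A$ containing a standout alternative $x\in A$, we have $x\in S$ for each $k\ge 1$ and each $S\in\mathcal{S}(I,A,k)$. *)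

theory Defs
  imports "Jordan_Normal_Form.Matrix" "HOL-Library.Extended_Real"
begin

text \<open>
  The dimension has to be quantified inside the notion of consistency, so points of $d$-dimensional
  space are members of \<^term>\<open>carrier_vec d :: real vec set\<close> (coordinates indexed from 0).
\<close>

definition dominates :: "real vec \<Rightarrow> real vec \<Rightarrow> bool" where
  "dominates y x \<longleftrightarrow>
     (\<forall>i<dim_vec x. x $ i \<le> y $ i) \<and> (\<exists>j<dim_vec x. x $ j < y $ j)"

definition alternatives :: "nat \<Rightarrow> real vec set \<Rightarrow> bool" where
  "alternatives d A \<longleftrightarrow>
     finite A \<and> A \<subseteq> carrier_vec d \<and> (\<forall>x\<in>A. \<forall>y\<in>A. \<not> dominates y x)"

definition dist1 :: "real vec \<Rightarrow> real vec \<Rightarrow> real" where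
  "dist1 x y = (\<Sum>i<dim_vec x. \<bar>x $ i - y $ i\<bar>)"

text \<open>The asymmetric quantity $\|x-y\|_+$.\<close>

definition excess :: "real vec \<Rightarrow> real vec \<Rightarrow> real" where
  "excess x y = (\<Sum>i<dim_vec x. max (x $ i - y $ i) 0)"

text \<open>
  A measure takes the subset and the ambient set of alternatives; uniformity ignores the latter.
\<close>

definition uniformity_measure :: "real vec set \<Rightarrow> real vec set \<Rightarrow> ereal" where
  "uniformity_measure S A =
     (if card S = 1 then \<infinity>
      else ereal (Min {dist1 x y | x y. x \<in> S \<and> y \<in> S \<and> x \<noteq> y}))"

definition coverage_measure :: "real vec set \<Rightarrow> real vec set \<Rightarrow> real" where
  "coverage_measure S A = Max ((\<lambda>a. Min ((\<lambda>s. dist1 a s) ` S)) ` A)"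

text \<open>
  The relation \<open>better\<close> records the direction of optimisation: \<open>better u v\<close> means that the value
  \<open>u\<close> is at least as good as \<open>v\<close>, so it is \<open>(\<ge>)\<close> for a measure to be maximised and \<open>(\<le>)\<close> for one
  to be minimised.
\<close>

definition optimal_subsets ::
  "('v \<Rightarrow> 'v \<Rightarrow> bool) \<Rightarrow> (real vec set \<Rightarrow> real vec set \<Rightarrow> 'v) \<Rightarrow> real vec set \<Rightarrow> nat
     \<Rightarrow> real vec set set" where
  "optimal_subsets better I A k =
     {S. S \<subseteq> A \<and> card S = k \<and> (\<forall>T. T \<subseteq> A \<and> card T = k \<longrightarrow> better (I S A) (I T A))}"

text \<open>
  If \<open>x\<close> is the only alternative, the minimum and the maximum range over the empty set; \<open>x\<close> then
  counts as standout. Consistency does not depend on this choice, because the only nonempty subset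
  of \<open>{x}\<close> contains \<open>x\<close>.
\<close>

definition standout :: "real vec set \<Rightarrow> real vec \<Rightarrow> bool" where
  "standout A x \<longleftrightarrow> x \<in> A \<and>
     (A - {x} \<noteq> {} \<longrightarrow>
        Min ((\<lambda>a. excess x a) ` (A - {x})) > Max ((\<lambda>a. excess a x) ` (A - {x})))"

definition standout_consistent ::
  "('v \<Rightarrow> 'v \<Rightarrow> bool) \<Rightarrow> (real vec set \<Rightarrow> real vec set \<Rightarrow> 'v) \<Rightarrow> bool" where
  "standout_consistent better I \<longleftrightarrow>
     (\<forall>d\<ge>1. \<forall>A x. alternatives d A \<and> standout A x \<longrightarrow>
        (\<forall>k\<ge>1. \<forall>S\<in>optimal_subsets better I A k. x \<in> S))"

end

theory Submission imports Defs begin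

text \<open>
  The single set \<open>A = {(2,0), (0,1)}\<close> with \<open>k = 1\<close> refutes both claims. Its first point is standout,
  but optimality of singletons cannot tell the two points apart: every singleton has uniformity
  \<open>\<infinity>\<close>, and by symmetry of the distance both singletons have coverage \<open>dist1 (2,0) (0,1)\<close>.
\<close>

text \<open>For \<open>k = 1\<close> the only rival of \<open>{y}\<close> is \<open>{x}\<close>, so
  \<open>{y}\<close> is optimal and omits \<open>x\<close>. Since \<open>better\<close> is an
  arbitrary relation, its reflexivity at the value of \<open>{y}\<close> is assumed too.\<close>

lemma standout_inconsistent_if_indifferent_on_singletons:
  assumes "alternatives d {x, y}" "d \<ge> 1" "standout {x, y} x" "x \<noteq> y"
    and "better (I {y} {x, y}) (I {x} {x, y})" "better (I {y} {x, y}) (I {y} {x, y})"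
  shows "\<not> standout_consistent better I"
proof
  assume consistent: "standout_consistent better I"
  have "T = {x} \<or> T = {y}" if "T \<subseteq> {x, y}" "card T = 1" for T
    using that by (auto simp: card_1_singleton_iff)
  then have "{y} \<in> optimal_subsets better I {x, y} 1"
    using assms(5,6) by (auto simp: optimal_subsets_def simp del: One_nat_def)
  with consistent assms(1-3) have "x \<in> {y}"
    unfolding standout_consistent_def by blast
  with \<open>x \<noteq> y\<close> show False by simp
qed

lemma dist1_self [simp]: "dist1 x x = 0"
  by (simp add: dist1_def)

lemma dist1_nonneg: "dist1 x y \<ge> 0"
  by (simp add: dist1_def sum_nonneg)

lemma dist1_commute: "dim_vec x = dim_vec y \<Longrightarrow> dist1 x y = dist1 y x"
  by (simp add: dist1_def abs_minus_commute)

text \<open>The chosen point is at distance 0 from itself, so the omitted one attains the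
  maximum.\<close>

lemma coverage_measure_singleton_of_pair:
  assumes "dim_vec x = dim_vec y"
  shows "coverage_measure {x} {x, y} = dist1 x y" "coverage_measure {y} {x, y} = dist1 x y"
  using dist1_commute[OF assms] dist1_nonneg[of x y]
  by (simp_all add: coverage_measure_def max_def)

theorem proposition20:
  "\<not> standout_consistent (\<ge>) uniformity_measure \<and> \<not> standout_consistent (\<le>) coverage_measure"
proof -
  define x :: "real vec" where "x = vec_of_list [2, 0]"
  define y :: "real vec" where "y = vec_of_list [0, 1]"
  have dim: "dim_vec x = 2" "dim_vec y = 2" by (simp_all add: x_def y_def)
  have coords: "x $ 0 = 2" "x $ 1 = 0" "y $ 0 = 0" "y $ 1 = 1"
    by (simp_all add: x_def y_def)
  have "x \<noteq> y" using coords by auto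
  \<comment> \<open>Each point is strictly ahead in one coordinate.\<close>
  have "\<not> x $ 1 \<ge> y $ 1" "\<not> y $ 0 \<ge> x $ 0" using coords by simp_all
  moreover have "(1::nat) < 2" "(0::nat) < 2" by simp_all
  ultimately have "\<not> dominates x y" "\<not> dominates y x"
    unfolding dominates_def dim by blast+
  moreover have "\<not> dominates u u" for u
    by (simp add: dominates_def)
  ultimately have alternatives: "alternatives 2 {x, y}"
    by (simp add: alternatives_def carrier_vecI dim)
  \<comment> \<open>With a single other point, \<open>Min\<close> and \<open>Max\<close> range over
    singletons, so standout reduces to 2 > 1.\<close>
  have "excess x y = 2" "excess y x = 1"
    using coords by (simp_all add: excess_def dim numeral_2_eq_2)
  moreover have "{x, y} - {x} = {y}" using \<open>x \<noteq> y\<close> by auto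
  ultimately have standout: "standout {x, y} x" by (simp add: standout_def)
  note inconsistent =
    standout_inconsistent_if_indifferent_on_singletons[OF alternatives _ standout \<open>x \<noteq> y\<close>]
  have "\<not> standout_consistent (\<ge>) uniformity_measure"
    by (rule inconsistent) (simp_all add: uniformity_measure_def)
  moreover have "\<not> standout_consistent (\<le>) coverage_measure"
    by (rule inconsistent) (simp_all add: coverage_measure_singleton_of_pair dim)
  ultimately show ?thesis by simp
qed

end
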